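(* Suppose $\{\mathbf{v}_1, \dots, \mathbf{v}_g\}$ is a $\mathbb{Z}$-basis for a lattice $\Lambda \subset \mathbb{R}^d$. Then there exists a $\mathbb{Z}$-basis $\{\mathbf{f}_1, \dots, \mathbf{f}_g\}$ for $\Lambda$ with the property that $\mathbf{f}_i \cdot \mathbf{f}_j \leq 0$ for all $i \neq j$.
   Context: $\mathbb{R}^d$ carries the usual Euclidean inner product, denoted $\cdot$. A lattice $\Lambda \subset \mathbb{R}^d$ is a discrete subgroup of $\mathbb{R}^d$ (not necessarily of full rank); a $\mathbb{Z}$-basis of $\Lambda$ is a set of $\mathbb{R}$-linearly independent vectors whose integer span is $\Lambda$. *)

theory Defs
  imports "HOL-Analysis.Analysis"
begin

text \<open>A lattice is a discrete additive subgroup; it need not have full rank.\<close>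

definition is_lattice :: "'a::real_normed_vector set \<Rightarrow> bool" where
  "is_lattice L \<longleftrightarrow>
     0 \<in> L \<and> (\<forall>x\<in>L. \<forall>y\<in>L. x + y \<in> L) \<and> (\<forall>x\<in>L. - x \<in> L) \<and> discrete L"

definition int_span :: "'a::real_vector set \<Rightarrow> 'a set" where
  "int_span B = {\<Sum>b\<in>T. of_int (c b) *\<^sub>R b |T (c :: 'a \<Rightarrow> int). finite T \<and> T \<subseteq> B}"

text \<open>Here \<open>independent\<close> is linear independence over the reals.\<close>

definition int_basis :: "'a::real_vector set \<Rightarrow> 'a set \<Rightarrow> bool" where
  "int_basis B L \<longleftrightarrow> independent B \<and> int_span B = L"

end

theory Submission
  imports Defs
begin

text \<open>
  The vectors are corrected one at a time. Suppose \<open>F\<close> is already pairwise non-acute and \<open>b\<close> is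
  the next vector. By linear independence some real combination \<open>y\<close> of \<open>F\<close> satisfies
  \<open>y \<bullet> x = 1\<close> for all \<open>x \<in> F\<close>. Rounding the coefficients of a large multiple \<open>T y\<close> to integers
  changes it by a vector of norm bounded independently of \<open>T\<close>, so some \<open>w\<close> in the integer span
  of \<open>F\<close> has \<open>w \<bullet> x \<ge> b \<bullet> x\<close> for all \<open>x \<in> F\<close>. Replacing \<open>b\<close> by \<open>b - w\<close> does not change the lattice.
\<close>

lemma int_span_finite:
  assumes "finite B"
  shows "int_span B = range (\<lambda>c. \<Sum>b\<in>B. of_int (c b) *\<^sub>R b)"
proof
  show "int_span B \<subseteq> range (\<lambda>c. \<Sum>b\<in>B. of_int (c b) *\<^sub>R b)"
  proof
    fix x assume "x \<in> int_span B"
    then obtain T c where T: "T \<subseteq> B" and x: "x = (\<Sum>b\<in>T. of_int (c b) *\<^sub>R b)"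
      unfolding int_span_def by blast
    have "x = (\<Sum>b\<in>B. of_int (if b \<in> T then c b else 0) *\<^sub>R b)"
      unfolding x by (rule sum.mono_neutral_cong_left) (use assms T in auto)
    then show "x \<in> range (\<lambda>c. \<Sum>b\<in>B. of_int (c b) *\<^sub>R b)"
      by (intro range_eqI[where x = "\<lambda>b. if b \<in> T then c b else 0"])
  qed
  show "range (\<lambda>c. \<Sum>b\<in>B. of_int (c b) *\<^sub>R b) \<subseteq> int_span B"
    unfolding int_span_def using assms by blast
qed

lemma int_span_add:
  assumes "finite B" "x \<in> int_span B" "y \<in> int_span B"
  shows "x + y \<in> int_span B"
proof -
  obtain c d where "x = (\<Sum>b\<in>B. of_int (c b) *\<^sub>R b)" "y = (\<Sum>b\<in>B. of_int (d b) *\<^sub>R b)"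
    using assms by (auto simp: int_span_finite)
  then have "x + y = (\<Sum>b\<in>B. of_int (c b + d b) *\<^sub>R b)"
    by (simp add: sum.distrib scaleR_left_distrib)
  then show ?thesis
    unfolding int_span_finite[OF assms(1)] by (rule range_eqI[where x = "\<lambda>b. c b + d b"])
qed

lemma int_span_scale:
  assumes "finite B" "x \<in> int_span B"
  shows "of_int n *\<^sub>R x \<in> int_span B"
proof -
  obtain c where "x = (\<Sum>b\<in>B. of_int (c b) *\<^sub>R b)"
    using assms by (auto simp: int_span_finite)
  then have "of_int n *\<^sub>R x = (\<Sum>b\<in>B. of_int (n * c b) *\<^sub>R b)"
    by (simp add: scaleR_sum_right)
  then show ?thesis
    unfolding int_span_finite[OF assms(1)] by (rule range_eqI[where x = "\<lambda>b. n * c b"])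
qed

text \<open>Splitting off the coefficient of \<open>b\<close> shows that the enlarged integer span
  depends on \<open>B\<close> only through \<open>int_span B\<close>.\<close>

lemma int_span_insert:
  assumes "finite B" "b \<notin> B"
  shows "int_span (insert b B) = {x. \<exists>n. x - of_int n *\<^sub>R b \<in> int_span B}"
proof (intro equalityI subsetI)
  fix x assume "x \<in> int_span (insert b B)"
  then obtain c where "x = (\<Sum>b\<in>insert b B. of_int (c b) *\<^sub>R b)"
    using assms by (auto simp: int_span_finite)
  then have "x - of_int (c b) *\<^sub>R b = (\<Sum>b\<in>B. of_int (c b) *\<^sub>R b)"
    using assms by simp
  then show "x \<in> {x. \<exists>n. x - of_int n *\<^sub>R b \<in> int_span B}"
    using assms(1) by (auto simp: int_span_finite)
next
  fix x assume "x \<in> {x. \<exists>n. x - of_int n *\<^sub>R b \<in> int_span B}"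
  then obtain n c where *: "x - of_int n *\<^sub>R b = (\<Sum>b\<in>B. of_int (c b) *\<^sub>R b)"
    using assms by (auto simp: int_span_finite)
  have "(\<Sum>a\<in>B. of_int ((c(b := n)) a) *\<^sub>R a) = (\<Sum>a\<in>B. of_int (c a) *\<^sub>R a)"
    using assms(2) by (intro sum.cong) auto
  then have "x = (\<Sum>a\<in>insert b B. of_int ((c(b := n)) a) *\<^sub>R a)"
    using * assms by (simp add: algebra_simps)
  then show "x \<in> int_span (insert b B)"
    using assms(1) by (auto simp: int_span_finite)
qed

text \<open>For each fixed coefficient \<open>n\<close>, exchanging \<open>b\<close> for
  \<open>b - w\<close> shifts the remainder by \<open>n\<close> times \<open>w\<close>, which
  already lies in \<open>int_span B\<close>.\<close>

lemma int_span_insert_diff: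
  assumes "finite B" "w \<in> int_span B" "b \<notin> B" "b - w \<notin> B"
  shows "int_span (insert (b - w) B) = int_span (insert b B)"
proof -
  have "x - of_int n *\<^sub>R (b - w) \<in> int_span B \<longleftrightarrow> x - of_int n *\<^sub>R b \<in> int_span B" for x n
    using int_span_add[OF assms(1) _ int_span_scale[OF assms(1,2), of n], of "x - of_int n *\<^sub>R b"]
      int_span_add[OF assms(1) _ int_span_scale[OF assms(1,2), of "- n"],
        of "x - of_int n *\<^sub>R (b - w)"]
    by (auto simp: algebra_simps)
  then show ?thesis
    using assms by (simp add: int_span_insert)
qed

text \<open>This lets an equality of integer spans be passed on to the real spans.\<close>

lemma span_int_span: "span (int_span B) = span B"
proof (rule span_eq[THEN iffD2], intro conjI)
  show "int_span B \<subseteq> span B"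
    unfolding int_span_def by (auto intro!: span_sum span_scale intro: span_base)
  have "b \<in> int_span B" if "b \<in> B" for b
    unfolding int_span_def using that
    by (intro CollectI exI[of _ "{b}"] exI[of _ "\<lambda>_. 1"]) auto
  then show "B \<subseteq> span (int_span B)"
    by (auto intro: span_base)
qed

text \<open>By independence some linear functional \<open>l\<close> is 1 on all of \<open>F\<close>,
  and \<open>adjoint l 1\<close> represents it as an inner product. Projecting that vector
  orthogonally onto \<open>span F\<close> leaves its inner products with \<open>F\<close>
  unchanged.\<close>

lemma independent_imp_inner_eq_1:
  fixes F :: "'a::euclidean_space set"
  assumes "independent F"
  obtains y where "y \<in> span F" "\<And>x. x \<in> F \<Longrightarrow> y \<bullet> x = 1"
proof -
  obtain l :: "'a \<Rightarrow> real" where l: "linear l" "\<And>x. x \<in> F \<Longrightarrow> l x = 1"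
    using linear_independent_extend[OF assms, of "\<lambda>_. 1"] by blast
  obtain y z where y: "y \<in> span F" and z: "\<And>x. x \<in> span F \<Longrightarrow> orthogonal z x"
    and yz: "adjoint l 1 = y + z"
    using orthogonal_subspace_decomp_exists[of F "adjoint l 1"] by blast
  have "y \<bullet> x = 1" if "x \<in> F" for x
  proof -
    have "1 = x \<bullet> adjoint l 1"
      using l that adjoint_works[OF l(1), of x 1] by simp
    also have "\<dots> = y \<bullet> x"
      using z[OF span_base[OF that]] unfolding yz
      by (simp add: orthogonal_def inner_add_right inner_commute)
    finally show ?thesis by simp
  qed
  with y show thesis by (rule that)
qed

lemma int_span_dominating:
  fixes F :: "'a::euclidean_space set" and b :: 'a
  assumes "independent F"
  obtains w where "w \<in> int_span F" "\<And>x. x \<in> F \<Longrightarrow> b \<bullet> x \<le> w \<bullet> x"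
proof -
  have fin: "finite F"
    using assms by (rule independent_imp_finite)
  obtain y where "y \<in> span F" and y1: "\<And>x. x \<in> F \<Longrightarrow> y \<bullet> x = 1"
    using independent_imp_inner_eq_1[OF assms] by blast
  then obtain r where y: "y = (\<Sum>x\<in>F. r x *\<^sub>R x)"
    using span_finite[OF fin] by auto
  \<comment> \<open>\<open>D\<close> bounds the rounding error, since each coefficient moves by at
    most 1. \<open>T\<close> is a sum rather than a maximum, so that it dominates every
    \<open>(norm b + D) * norm x\<close> and also makes sense for empty \<open>F\<close>.\<close>
  define D where "D = (\<Sum>x\<in>F. norm x)"
  define T where "T = (\<Sum>x\<in>F. (norm b + D) * norm x)"
  define w where "w = (\<Sum>x\<in>F. of_int \<lfloor>T * r x\<rfloor> *\<^sub>R x)"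
  have D0: "0 \<le> D"
    unfolding D_def by (intro sum_nonneg) auto
  have "T *\<^sub>R y - w = (\<Sum>x\<in>F. (T * r x - of_int \<lfloor>T * r x\<rfloor>) *\<^sub>R x)"
    unfolding y w_def by (simp add: scaleR_sum_right sum_subtractf scaleR_left_diff_distrib)
  also have "norm \<dots> \<le> D"
    unfolding D_def
  proof (rule sum_norm_le)
    fix x
    have "\<bar>T * r x - of_int \<lfloor>T * r x\<rfloor>\<bar> \<le> 1" by linarith
    then show "norm ((T * r x - of_int \<lfloor>T * r x\<rfloor>) *\<^sub>R x) \<le> norm x"
      by (simp add: mult_left_le_one_le)
  qed
  finally have close: "norm (T *\<^sub>R y - w) \<le> D" .
  have "b \<bullet> x \<le> w \<bullet> x" if "x \<in> F" for x
  proof -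
    \<comment> \<open>As \<open>y \<bullet> x = 1\<close>, the goal amounts to bounding this inner
      product by \<open>T\<close>.\<close>
    have "(b + (T *\<^sub>R y - w)) \<bullet> x \<le> norm (b + (T *\<^sub>R y - w)) * norm x"
      by (rule norm_cauchy_schwarz)
    also have "\<dots> \<le> (norm b + D) * norm x"
      using norm_triangle_ineq[of b "T *\<^sub>R y - w"] close by (intro mult_right_mono) auto
    also have "\<dots> \<le> T"
      unfolding T_def using fin that D0
      by (intro member_le_sum[where f = "\<lambda>x. (norm b + D) * norm x"]) auto
    finally show ?thesis
      using y1[OF that] by (simp add: inner_add_left inner_diff_left)
  qed
  moreover have "w \<in> int_span F"
    unfolding w_def int_span_finite[OF fin] by (rule range_eqI) (rule refl)
  ultimately show thesis
    by (intro that)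
qed

text \<open>Earlier vectors are never altered again, so only the pairs containing the new vector
  need checking. The cardinality is carried along so that the result can be indexed by
  \<open>{1..g}\<close>.\<close>

lemma exists_nonacute_int_basis:
  fixes B :: "'a::euclidean_space set"
  assumes "finite B" "independent B"
  shows "\<exists>F. finite F \<and> card F = card B \<and> independent F \<and> int_span F = int_span B \<and>
           pairwise (\<lambda>x y. x \<bullet> y \<le> 0) F"
  using assms
proof (induction B rule: finite_induct)
  case empty
  then show ?case by (intro exI[of _ "{}"]) auto
next
  case (insert b B)
  then have ind: "independent B" and b: "b \<notin> span B"
    by (auto simp: independent_insert)
  then obtain F where F: "finite F" "card F = card B" "independent F"
    "int_span F = int_span B" "pairwise (\<lambda>x y. x \<bullet> y \<le> 0) F"
    using insert by blast
  have sp: "span F = span B"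
    using span_int_span[of F] span_int_span[of B] F(4) by simp
  obtain w where w: "w \<in> int_span F" "\<And>x. x \<in> F \<Longrightarrow> b \<bullet> x \<le> w \<bullet> x"
    using int_span_dominating[OF F(3)] by blast
  have "w \<in> span F"
    using w(1) span_base span_int_span by blast
  \<comment> \<open>This yields both independence of the enlarged set and, through
    \<open>b - w \<notin> F\<close>, the growth of its cardinality by one.\<close>
  then have bw: "b - w \<notin> span F"
    using b sp span_add[of "b - w" F w] by auto
  then have nin: "b - w \<notin> F" "b \<notin> F"
    using b sp by (auto dest: span_base)
  \<comment> \<open>First \<open>b - w\<close> is exchanged for \<open>b\<close> over
    \<open>F\<close>; then \<open>F\<close> may be exchanged for \<open>B\<close>, as their integer
    spans agree and \<open>b\<close> lies in neither.\<close>
  have "int_span (insert (b - w) F) = int_span (insert b B)"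
    using int_span_insert_diff[OF F(1) w(1) nin(2,1)] F(1,4) nin insert.hyps
    by (simp add: int_span_insert)
  moreover have "pairwise (\<lambda>x y. x \<bullet> y \<le> 0) (insert (b - w) F)"
    using F(5) w(2) by (auto simp: pairwise_insert inner_diff_left inner_diff_right inner_commute)
  moreover have "independent (insert (b - w) F)"
    using F(3) bw by (rule independent_insertI[rotated])
  ultimately show ?case
    using F nin insert.hyps by (intro exI[of _ "insert (b - w) F"]) auto
qed

theorem theorem3p11:
  fixes \<Lambda> :: "(real ^ 'd) set" and v :: "nat \<Rightarrow> real ^ 'd" and g :: nat
  assumes "is_lattice \<Lambda>"
    and "inj_on v {1..g}"
    and "int_basis (v ` {1..g}) \<Lambda>"
  shows "\<exists>f :: nat \<Rightarrow> real ^ 'd.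
           inj_on f {1..g} \<and> int_basis (f ` {1..g}) \<Lambda> \<and>
           (\<forall>i\<in>{1..g}. \<forall>j\<in>{1..g}. i \<noteq> j \<longrightarrow> f i \<bullet> f j \<le> 0)"
proof -
  obtain F where F: "finite F" "card F = card (v ` {1..g})" "independent F"
    "int_span F = \<Lambda>" "pairwise (\<lambda>x y. x \<bullet> y \<le> 0) F"
    using exists_nonacute_int_basis[of "v ` {1..g}"] assms(3) unfolding int_basis_def by auto
  have "card {1..g} = card F"
    using F(2) assms(2) by (simp add: card_image)
  then obtain f where f: "bij_betw f {1..g} F"
    using finite_same_card_bij[of "{1..g}" F] F(1) by auto
  then have inj: "inj_on f {1..g}" and im: "f ` {1..g} = F"
    by (auto simp: bij_betw_def)
  have "f i \<bullet> f j \<le> 0" if "i \<in> {1..g}" "j \<in> {1..g}" "i \<noteq> j" for i j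
    using F(5) inj im that by (metis imageI inj_onD pairwiseD)
  then show ?thesis
    using inj im F(3,4) unfolding int_basis_def by blast
qed

end
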